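(* Let $(A,\cdot)$ be a group, let $M$ be an abelian subgroup of $\operatorname{Aut}(A,\cdot)$, and let $\mathcal{S}$ be the set of group homomorphisms $\gamma\colon A\to M$ such that $\gamma(\psi(a))=\gamma(a)$ for all $a\in A$ and $\psi\in M$. Then $((A,\circ_\gamma)\mid\gamma\in\mathcal{S})$ is a brace block, where $$a\circ_\gamma b=a\cdot\gamma(a)(b)\qquad (a,b\in A).$$ Moreover, $(A,\circ_{\gamma_1},\circ_{\gamma_2})$ is $\gamma$-homomorphic for all $\gamma_1,\gamma_2\in\mathcal{S}$.
   Context: A skew brace (meaning skew left brace) is a set $A$ with two group structures $(A,\cdot)$ (the additive group) and $(A,\circ)$ (the multiplicative group) such that $a\circ(b\cdot c)=(a\circ b)\cdot a^{-1}\cdot(a\circ c)$ for all $a,b,c\in A$, where $a^{-1}$ is the inverse of $a$ in $(A,\cdot)$. A bi-skew brace is a skew brace $(A,\cdot,\circ)$ such that $(A,\circ,\cdot)$ is also a skew brace. A brace block on a set $A$ is a family $((A,\circ_i)\mid i\in I)$ of group operations $\circ_i$ on $A$ such that $(A,\circ_i,\circ_j)$ is a bi-skew brace for all $i,j\in I$. A skew brace $(A,\cdot,\circ)$ is called $\gamma$-homomorphic if its gamma function, i.e. the map from $A$ to $\operatorname{Aut}(A,\cdot)$ sending $a$ to the automorphism $b\mapsto a^{-1}\cdot(a\circ b)$, is a group homomorphism with respect to the additive group $(A,\cdot)$. (For the skew brace $(A,\circ_{\gamma_1},\circ_{\gamma_2})$ the additive group is $(A,\circ_{\gamma_1})$ and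 the multiplicative group is $(A,\circ_{\gamma_2})$.) *)

theory Defs
  imports "HOL-Algebra.Bij"
begin

text \<open>A skew (left) brace is a pair of groups on one carrier: the first argument is the additive
  group, the second the multiplicative group.\<close>

definition skew_brace :: "('a, 'm) monoid_scheme \<Rightarrow> ('a, 'n) monoid_scheme \<Rightarrow> bool" where
  "skew_brace A B \<longleftrightarrow> group A \<and> group B \<and> carrier B = carrier A \<and>
     (\<forall>a\<in>carrier A. \<forall>b\<in>carrier A. \<forall>c\<in>carrier A.
        a \<otimes>\<^bsub>B\<^esub> (b \<otimes>\<^bsub>A\<^esub> c) = (a \<otimes>\<^bsub>B\<^esub> b) \<otimes>\<^bsub>A\<^esub> inv\<^bsub>A\<^esub> a \<otimes>\<^bsub>A\<^esub> (a \<otimes>\<^bsub>B\<^esub> c))"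

definition bi_skew_brace :: "('a, 'm) monoid_scheme \<Rightarrow> ('a, 'n) monoid_scheme \<Rightarrow> bool" where
  "bi_skew_brace A B \<longleftrightarrow> skew_brace A B \<and> skew_brace B A"

definition brace_block :: "'a set \<Rightarrow> 'i set \<Rightarrow> ('i \<Rightarrow> ('a, 'm) monoid_scheme) \<Rightarrow> bool" where
  "brace_block X I G \<longleftrightarrow>
     (\<forall>i\<in>I. group (G i) \<and> carrier (G i) = X) \<and>
     (\<forall>i\<in>I. \<forall>j\<in>I. bi_skew_brace (G i) (G j))"

text \<open>Both levels are restricted to the carrier, because the elements of \<^const>\<open>auto\<close> are
  extensional functions.\<close>

definition gamma_function ::
    "('a, 'm) monoid_scheme \<Rightarrow> ('a, 'n) monoid_scheme \<Rightarrow> 'a \<Rightarrow> 'a \<Rightarrow> 'a" where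
  "gamma_function A B = (\<lambda>a\<in>carrier A. \<lambda>b\<in>carrier A. inv\<^bsub>A\<^esub> a \<otimes>\<^bsub>A\<^esub> (a \<otimes>\<^bsub>B\<^esub> b))"

definition gamma_homomorphic :: "('a, 'm) monoid_scheme \<Rightarrow> ('a, 'n) monoid_scheme \<Rightarrow> bool" where
  "gamma_homomorphic A B \<longleftrightarrow> skew_brace A B \<and> gamma_function A B \<in> hom A (AutoGroup A)"

definition invariant_homs :: "('a, 'm) monoid_scheme \<Rightarrow> ('a \<Rightarrow> 'a) set \<Rightarrow> ('a \<Rightarrow> 'a \<Rightarrow> 'a) set" where
  "invariant_homs A M =
     {\<gamma> \<in> hom A (AutoGroup A\<lparr>carrier := M\<rparr>). \<forall>a\<in>carrier A. \<forall>\<psi>\<in>M. \<gamma> (\<psi> a) = \<gamma> a}"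

text \<open>The record needs a unit; since \<open>\<gamma>\<close> is a homomorphism, the identity element for the new
  operation is necessarily that of \<open>A\<close>.\<close>

definition circ_group :: "('a, 'm) monoid_scheme \<Rightarrow> ('a \<Rightarrow> 'a \<Rightarrow> 'a) \<Rightarrow> 'a monoid" where
  "circ_group A \<gamma> =
     \<lparr>carrier = carrier A, mult = (\<lambda>a b. a \<otimes>\<^bsub>A\<^esub> \<gamma> a b), one = \<one>\<^bsub>A\<^esub>\<rparr>"

end

theory Submission
  imports Defs
begin

text \<open>Write \<open>S(A)\<close> for the set of \<open>M\<close>-invariant homomorphisms \<open>A \<rightarrow> M\<close>.  The proof rests on a
  change of base point: all groups \<open>(A, \<circ>\<^sub>\<gamma>)\<close> with \<open>\<gamma> \<in> S(A)\<close> play the same role as \<open>A\<close>.  Indeed,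
  invariance of \<open>\<gamma>\<close> makes every \<open>\<psi> \<in> M\<close> an automorphism of \<open>\<circ>\<^sub>\<gamma>\<close> as well, because
  \<open>\<psi> (a \<cdot> \<gamma>(a)(b)) = \<psi>(a) \<cdot> \<gamma>(\<psi>(a))(\<psi>(b))\<close> when \<open>M\<close> is abelian; and invariance of any other
  \<open>\<delta> \<in> S(A)\<close> gives \<open>\<delta>(a \<cdot> \<gamma>(a)(b)) = \<delta>(a) \<delta>(b)\<close>, so that \<open>\<delta>\<close> is an invariant homomorphism for
  \<open>\<circ>\<^sub>\<gamma>\<close> too (lemmas \<open>circ_group_base_change\<close> and \<open>invariant_homs_base_change\<close>).

  Given \<open>\<gamma>1\<close> and \<open>\<gamma>2\<close> in \<open>S(A)\<close>, the pointwise quotient \<open>\<theta>(a) = \<gamma>1(a)\<inverse> \<gamma>2(a)\<close> lies in \<open>S(A)\<close>,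
  again because \<open>M\<close> is abelian, and \<open>a \<circ>\<^sub>\<gamma>\<^sub>2 b = a \<circ>\<^sub>\<gamma>\<^sub>1 \<theta>(a)(b)\<close>.  Hence the pair
  \<open>(\<circ>\<^sub>\<gamma>\<^sub>1, \<circ>\<^sub>\<gamma>\<^sub>2)\<close> is of the form \<open>(\<cdot>, \<circ>\<^sub>\<theta>)\<close> over the new base \<open>(A, \<circ>\<^sub>\<gamma>\<^sub>1)\<close>, and a pair of that form is a
  skew brace with gamma function \<open>\<theta>\<close>, a homomorphism by choice
  (lemma \<open>gamma_homomorphic_of_twist\<close>).  Exchanging \<open>\<gamma>1\<close> and \<open>\<gamma>2\<close> gives the bi-skew property.\<close>

text \<open>The group structure of \<open>M\<close> is taken from the bijections of the carrier, where it does not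
  mention the operation of \<open>A\<close>; this is what lets the operation of \<open>A\<close> vary while \<open>M\<close> stays
  fixed.\<close>

locale abelian_automorphisms = group A for A :: "('a, 'm) monoid_scheme" (structure) +
  fixes M :: "('a \<Rightarrow> 'a) set"
  assumes M_auto: "M \<subseteq> auto A"
    and M_comm_group: "comm_group (BijGroup (carrier A)\<lparr>carrier := M\<rparr>)"
begin

abbreviation \<M> :: "('a \<Rightarrow> 'a) monoid" where
  "\<M> \<equiv> BijGroup (carrier A)\<lparr>carrier := M\<rparr>"

sublocale M: comm_group \<M>
  by (rule M_comm_group)

lemma M_closed [simp]: "\<psi> \<in> M \<Longrightarrow> x \<in> carrier A \<Longrightarrow> \<psi> x \<in> carrier A"
  using M_auto by (auto simp: auto_def hom_def)

lemma M_mult [simp]: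
  "\<psi> \<in> M \<Longrightarrow> x \<in> carrier A \<Longrightarrow> y \<in> carrier A \<Longrightarrow> \<psi> (x \<otimes> y) = \<psi> x \<otimes> \<psi> y"
  using M_auto by (auto simp: auto_def hom_def)

lemma M_one [simp]: "\<psi> \<in> M \<Longrightarrow> \<psi> \<one> = \<one>"
  using M_auto by (auto simp: auto_def intro: hom_one[OF _ is_group is_group])

lemma M_Bij: "\<psi> \<in> M \<Longrightarrow> \<psi> \<in> Bij (carrier A)"
  using M_auto by (auto simp: auto_def)

lemma M_comp:
  "\<psi> \<in> M \<Longrightarrow> \<phi> \<in> M \<Longrightarrow> x \<in> carrier A \<Longrightarrow> (\<psi> \<otimes>\<^bsub>\<M>\<^esub> \<phi>) x = \<psi> (\<phi> x)"
  by (simp add: BijGroup_def M_Bij compose_eq)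

lemma M_id: "x \<in> carrier A \<Longrightarrow> \<one>\<^bsub>\<M>\<^esub> x = x"
  by (simp add: BijGroup_def)

lemma M_commute:
  assumes "\<psi> \<in> M" "\<phi> \<in> M" "x \<in> carrier A"
  shows "\<psi> (\<phi> x) = \<phi> (\<psi> x)"
  using M.m_comm[of \<psi> \<phi>] assms M_comp[of \<psi> \<phi> x] M_comp[of \<phi> \<psi> x] by simp

lemma invariant_homs_iff:
  "\<gamma> \<in> invariant_homs A M \<longleftrightarrow>
     \<gamma> \<in> hom A \<M> \<and> (\<forall>a\<in>carrier A. \<forall>\<psi>\<in>M. \<gamma> (\<psi> a) = \<gamma> a)"
  by (simp add: invariant_homs_def AutoGroup_def)

context
  fixes \<gamma>
  assumes \<gamma>: "\<gamma> \<in> invariant_homs A M"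
begin

lemma \<gamma>_hom: "\<gamma> \<in> hom A \<M>"
  and \<gamma>_invariant: "a \<in> carrier A \<Longrightarrow> \<psi> \<in> M \<Longrightarrow> \<gamma> (\<psi> a) = \<gamma> a"
  using \<gamma> by (auto simp: invariant_homs_iff)

lemma \<gamma>_in_M: "a \<in> carrier A \<Longrightarrow> \<gamma> a \<in> M"
  using hom_in_carrier[OF \<gamma>_hom] by simp

lemma \<gamma>_mult:
  "a \<in> carrier A \<Longrightarrow> b \<in> carrier A \<Longrightarrow> \<gamma> (a \<otimes> b) = \<gamma> a \<otimes>\<^bsub>\<M>\<^esub> \<gamma> b"
  using hom_mult[OF \<gamma>_hom] .

lemma \<gamma>_mult_apply:
  "a \<in> carrier A \<Longrightarrow> b \<in> carrier A \<Longrightarrow> x \<in> carrier A \<Longrightarrow> \<gamma> (a \<otimes> b) x = \<gamma> a (\<gamma> b x)"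
  by (simp only: \<gamma>_mult M_comp \<gamma>_in_M)

lemma \<gamma>_one: "x \<in> carrier A \<Longrightarrow> \<gamma> \<one> x = x"
  using hom_one[OF \<gamma>_hom is_group M.is_group] M_id by simp

lemma group_circ_group: "group (circ_group A \<gamma>)"
proof (rule groupI)
  fix a assume "a \<in> carrier (circ_group A \<gamma>)"
  then have a: "a \<in> carrier A" by (simp add: circ_group_def)
  \<comment> \<open>Invariance gives \<open>\<gamma> (\<gamma>(a\<inverse>)(a\<inverse>)) = \<gamma>(a\<inverse>)\<close>, so this element is a left inverse for \<open>\<circ>\<^sub>\<gamma>\<close>.\<close>
  let ?b = "\<gamma> (inv a) (inv a)"
  have "?b \<otimes> \<gamma> ?b a = \<gamma> (inv a) (inv a) \<otimes> \<gamma> (inv a) a"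
    using a by (simp only: \<gamma>_in_M \<gamma>_invariant inv_closed)
  also have "\<dots> = \<gamma> (inv a) (inv a \<otimes> a)"
    using a by (simp only: M_mult \<gamma>_in_M inv_closed)
  also have "\<dots> = \<one>"
    using a by (simp add: \<gamma>_in_M del: M_mult)
  finally show "\<exists>b\<in>carrier (circ_group A \<gamma>). b \<otimes>\<^bsub>circ_group A \<gamma>\<^esub> a = \<one>\<^bsub>circ_group A \<gamma>\<^esub>"
    using a by (intro bexI[of _ ?b]) (simp_all add: circ_group_def \<gamma>_in_M)
qed (simp_all add: circ_group_def \<gamma>_in_M \<gamma>_invariant \<gamma>_mult_apply \<gamma>_one m_assoc)

text \<open>Every \<open>\<psi> \<in> M\<close> stays an automorphism: \<open>\<psi>\<close> commutes with \<open>\<gamma>(a) \<in> M\<close>, and invariance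
  replaces \<open>\<gamma>(a)\<close> by \<open>\<gamma>(\<psi>(a))\<close>.\<close>

lemma circ_group_base_change: "abelian_automorphisms (circ_group A \<gamma>) M"
proof (intro abelian_automorphisms.intro abelian_automorphisms_axioms.intro)
  show "group (circ_group A \<gamma>)" by (rule group_circ_group)
  show "comm_group (BijGroup (carrier (circ_group A \<gamma>))\<lparr>carrier := M\<rparr>)"
    using M_comm_group by (simp add: circ_group_def)
  show "M \<subseteq> auto (circ_group A \<gamma>)"
  proof
    fix \<psi> assume \<psi>: "\<psi> \<in> M"
    have "\<psi> (a \<otimes> \<gamma> a b) = \<psi> a \<otimes> \<gamma> (\<psi> a) (\<psi> b)" if "a \<in> carrier A" "b \<in> carrier A" for a b
      using that \<psi> M_commute[of \<psi> "\<gamma> a" b] by (simp add: \<gamma>_in_M \<gamma>_invariant)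
    then show "\<psi> \<in> auto (circ_group A \<gamma>)"
      using \<psi> M_Bij by (auto simp: auto_def hom_def circ_group_def \<gamma>_in_M)
  qed
qed

end

lemma invariant_homs_base_change:
  assumes \<gamma>: "\<gamma> \<in> invariant_homs A M" and \<delta>: "\<delta> \<in> invariant_homs A M"
  shows "\<delta> \<in> invariant_homs (circ_group A \<gamma>) M"
proof -
  interpret C: abelian_automorphisms "circ_group A \<gamma>" M
    by (rule circ_group_base_change[OF \<gamma>])
  have "\<delta> (a \<otimes> \<gamma> a b) = \<delta> a \<otimes>\<^bsub>\<M>\<^esub> \<delta> b" if "a \<in> carrier A" "b \<in> carrier A" for a b
    using that by (simp add: \<gamma>_mult[OF \<delta>] \<gamma>_invariant[OF \<delta>] \<gamma>_in_M[OF \<gamma>])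
  then show ?thesis
    using \<gamma>_in_M[OF \<delta>] \<gamma>_invariant[OF \<delta>] unfolding C.invariant_homs_iff
    by (simp add: hom_def circ_group_def)
qed

lemma invariant_homs_quotient:
  assumes \<gamma>: "\<gamma> \<in> invariant_homs A M" and \<delta>: "\<delta> \<in> invariant_homs A M"
  shows "(\<lambda>a. inv\<^bsub>\<M>\<^esub> \<gamma> a \<otimes>\<^bsub>\<M>\<^esub> \<delta> a) \<in> invariant_homs A M"
proof -
  have "(\<lambda>a. inv\<^bsub>\<M>\<^esub> \<gamma> a \<otimes>\<^bsub>\<M>\<^esub> \<delta> a) \<in> hom A \<M>"
  proof (rule homI)
    fix a b assume ab: "a \<in> carrier A" "b \<in> carrier A"
    then have "\<gamma> a \<in> carrier \<M>" "\<gamma> b \<in> carrier \<M>" "\<delta> a \<in> carrier \<M>" "\<delta> b \<in> carrier \<M>"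
      using \<gamma> \<delta> by (simp_all add: \<gamma>_in_M)
    then show "inv\<^bsub>\<M>\<^esub> \<gamma> (a \<otimes> b) \<otimes>\<^bsub>\<M>\<^esub> \<delta> (a \<otimes> b)
        = inv\<^bsub>\<M>\<^esub> \<gamma> a \<otimes>\<^bsub>\<M>\<^esub> \<delta> a \<otimes>\<^bsub>\<M>\<^esub> (inv\<^bsub>\<M>\<^esub> \<gamma> b \<otimes>\<^bsub>\<M>\<^esub> \<delta> b)"
      using ab M.inv_mult[of "\<gamma> a" "\<gamma> b"]
      by (simp only: \<gamma>_mult[OF \<gamma>] \<gamma>_mult[OF \<delta>] M.m_ac M.m_closed M.inv_closed)
  next
    fix a assume "a \<in> carrier A"
    then show "inv\<^bsub>\<M>\<^esub> \<gamma> a \<otimes>\<^bsub>\<M>\<^esub> \<delta> a \<in> carrier \<M>"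
      using \<gamma> \<delta> by (intro M.m_closed M.inv_closed) (simp_all add: \<gamma>_in_M)
  qed
  then show ?thesis
    using \<gamma>_invariant[OF \<gamma>] \<gamma>_invariant[OF \<delta>] by (simp add: invariant_homs_iff)
qed

text \<open>The multiplicative group is only required to agree with \<open>\<circ>\<^sub>\<theta>\<close> on the carrier: after a change
  of base, the two descriptions of the same operation may differ outside the carrier, so the
  records need not be equal.\<close>

lemma gamma_homomorphic_of_twist:
  assumes \<theta>: "\<theta> \<in> invariant_homs A M"
    and B: "group B" "carrier B = carrier A"
    and mult_B: "\<And>a b. a \<in> carrier A \<Longrightarrow> b \<in> carrier A \<Longrightarrow> a \<otimes>\<^bsub>B\<^esub> b = a \<otimes> \<theta> a b"
  shows "gamma_homomorphic A B"
proof -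
  note [simp] = \<gamma>_in_M[OF \<theta>]
  have cancel: "inv a \<otimes> (a \<otimes> x) = x" if "a \<in> carrier A" "x \<in> carrier A" for a x
    using that by (simp flip: m_assoc)
  have skew: "skew_brace A B"
    using B by (simp add: skew_brace_def is_group mult_B m_assoc cancel)
  have gamma: "gamma_function A B a = \<theta> a" if a: "a \<in> carrier A" for a
  proof (rule extensionalityI[of _ "carrier A"])
    show "gamma_function A B a \<in> extensional (carrier A)"
      using a by (simp add: gamma_function_def)
    show "\<theta> a \<in> extensional (carrier A)"
      using a by (intro Bij_imp_extensional M_Bij) simp
    show "gamma_function A B a b = \<theta> a b" if "b \<in> carrier A" for b
      using a that by (simp add: gamma_function_def mult_B cancel)
  qed
  have "\<theta> \<in> hom A (AutoGroup A)"
    using \<gamma>_hom[OF \<theta>] M_auto by (auto simp: hom_def AutoGroup_def)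
  then have "gamma_function A B \<in> hom A (AutoGroup A)"
    using gamma by (rule hom_eq)
  with skew show ?thesis
    by (simp add: gamma_homomorphic_def)
qed

lemma gamma_homomorphic_circ_groups:
  assumes \<gamma>1: "\<gamma>1 \<in> invariant_homs A M" and \<gamma>2: "\<gamma>2 \<in> invariant_homs A M"
  shows "gamma_homomorphic (circ_group A \<gamma>1) (circ_group A \<gamma>2)"
proof -
  define \<theta> where "\<theta> = (\<lambda>a. inv\<^bsub>\<M>\<^esub> \<gamma>1 a \<otimes>\<^bsub>\<M>\<^esub> \<gamma>2 a)"
  have \<theta>: "\<theta> \<in> invariant_homs A M"
    unfolding \<theta>_def using \<gamma>1 \<gamma>2 by (rule invariant_homs_quotient)
  have \<theta>_apply: "\<gamma>1 a (\<theta> a b) = \<gamma>2 a b" if a: "a \<in> carrier A" and b: "b \<in> carrier A" for a b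
  proof -
    have in_M: "\<gamma>1 a \<in> carrier \<M>" "\<gamma>2 a \<in> carrier \<M>"
      using a \<gamma>1 \<gamma>2 by (simp_all add: \<gamma>_in_M)
    have "\<gamma>1 a \<otimes>\<^bsub>\<M>\<^esub> \<theta> a = \<gamma>2 a"
      using in_M by (simp only: \<theta>_def M.m_assoc[symmetric] M.inv_closed M.r_inv M.l_one)
    then show ?thesis
      using M_comp[of "\<gamma>1 a" "\<theta> a" b] in_M \<gamma>_in_M[OF \<theta> a] b by simp
  qed
  interpret C: abelian_automorphisms "circ_group A \<gamma>1" M
    by (rule circ_group_base_change[OF \<gamma>1])
  show ?thesis
  proof (rule C.gamma_homomorphic_of_twist)
    show "\<theta> \<in> invariant_homs (circ_group A \<gamma>1) M"
      using \<gamma>1 \<theta> by (rule invariant_homs_base_change)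
    show "group (circ_group A \<gamma>2)"
      using \<gamma>2 by (rule group_circ_group)
  qed (simp_all add: circ_group_def \<theta>_apply)
qed

end

theorem theorem6p6:
  fixes A :: "('a, 'm) monoid_scheme" and M :: "('a \<Rightarrow> 'a) set"
  assumes "group A"
    and "subgroup M (AutoGroup A)"
    and "comm_group (AutoGroup A\<lparr>carrier := M\<rparr>)"
  shows "brace_block (carrier A) (invariant_homs A M) (circ_group A) \<and>
    (\<forall>\<gamma>1\<in>invariant_homs A M. \<forall>\<gamma>2\<in>invariant_homs A M.
       gamma_homomorphic (circ_group A \<gamma>1) (circ_group A \<gamma>2))"
proof -
  interpret abelian_automorphisms A M
  proof (intro abelian_automorphisms.intro abelian_automorphisms_axioms.intro)
    show "M \<subseteq> auto A"
      using subgroup.subset[OF assms(2)] by (simp add: AutoGroup_def)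
    show "comm_group (BijGroup (carrier A)\<lparr>carrier := M\<rparr>)"
      using assms(3) by (simp add: AutoGroup_def)
  qed (rule assms(1))
  have "carrier (circ_group A \<gamma>) = carrier A" for \<gamma>
    by (simp add: circ_group_def)
  then show ?thesis
    using gamma_homomorphic_circ_groups group_circ_group
    by (simp add: brace_block_def bi_skew_brace_def gamma_homomorphic_def)
qed

end
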